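(* Let $n\geq 2$ be an integer, let $\xi\in[0,\pi]$, and set $b_s := \cos\left(\frac{\xi+2\pi s}{n}\right)$ for $s=1,\ldots,n$. Let $e_0 := 1$ and, for $1\le m\le n$, $$e_m(b_1, \dots, b_n) := \sum_{1 \leq j_1 < \cdots < j_m \leq n} b_{j_1} \cdots b_{j_m}.$$ Then: (i) if $n$ is odd, $e_n(b_1,\ldots,b_n) = \frac{1}{2^{n-1}}\cos\xi$; (ii) if $n$ is even, $e_n(b_1,\ldots,b_n) = \frac{1}{2^{n-1}}\left((-1)^{n/2}-\cos\xi\right)$; (iii) $e_m(b_1,\dots,b_n)=0$ for every odd integer $m$ with $1\le m\le n-1$, and for every integer $j$ with $0\le j<[n/2]$, $$e_{2j}(b_1,\ldots,b_n) = n(-1)^j\frac{(n-j-1)!}{2^{2j}\,j!\,(n-2j)!}.$$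
   Context: $[x]$ denotes the integer part of a real number $x$. *)

theory Defs
  imports Complex_Main
begin

(* Strictly increasing index tuples j_1 < ... < j_m in {1..n} are identified with the
   m-element subsets of {1..n}.  For m = 0 the only such subset is empty and the sum is 1. *)
definition elem_sym :: "nat \<Rightarrow> nat \<Rightarrow> (nat \<Rightarrow> real) \<Rightarrow> real" where
  "elem_sym n m b = (\<Sum>J | J \<subseteq> {1..n} \<and> card J = m. \<Prod>j\<in>J. b j)"

end

theory Submission
  imports Defs "HOL-Computational_Algebra.Polynomial"
begin

text \<open>
  The numbers \<open>b s\<close> are the roots, counted with multiplicity, of the equation
  \<open>T n x = cos \<xi>\<close>, where \<open>T n\<close> is the Chebyshev polynomial of the first kind:
  \<open>2 ^ (n - 1) * (\<Prod>s = 1..n. x - b s) = T n x - cos \<xi>\<close>.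
  By Vieta's formula (lemma \<open>coeff_prod_linear\<close>) the elementary symmetric functions of the \<open>b s\<close>
  are, up to sign and scaling, the coefficients of the right-hand side. All of these except the
  constant one are coefficients of \<open>T n\<close>, which the recurrence of the \<open>T n\<close> determines
  (lemma \<open>coeff_chebyshev_even\<close>).

  The factorisation holds also when some of the \<open>b s\<close> coincide, as can happen for \<open>\<xi> = 0\<close> or
  \<open>\<xi> = pi\<close>, because it is not obtained by finding roots of \<open>T n x = cos \<xi>\<close>.
  Instead, for \<open>x = cos \<theta>\<close> and \<open>z = cis \<theta>\<close> one has
  \<open>2 * z * (cos \<theta> - cos \<phi>) = (z - cis \<phi>) * (z - cis (- \<phi>))\<close>.
  For \<open>\<phi> = (\<xi> + 2 * pi * s) / n\<close> with \<open>s = 1, \<dots>, n\<close>, the numbers \<open>cis \<phi>\<close> are the \<open>n\<close>-th roots of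
  \<open>cis \<xi>\<close>, so the product over \<open>s\<close> is
  \<open>(z ^ n - cis \<xi>) * (z ^ n - cis (- \<xi>)) = 2 * z ^ n * (cos (n * \<theta>) - cos \<xi>)\<close>.
  The two polynomials thus agree at the infinitely many points of \<open>{-1..1}\<close>.
\<close>

section \<open>Elementary symmetric functions as coefficients\<close>

lemma coeff_prod_linear:
  assumes "m \<le> n"
  shows "coeff (\<Prod>s\<in>{1..n}. [:- b s, 1:]) (n - m) = (-1) ^ m * elem_sym n m b"
proof -
  have lin: "(\<Prod>s\<in>{1..n}. [:- b s, 1:]) = (\<Prod>s\<in>{1..n}. [:0, 1:] - [:b s:])"
    by simp
  have summand: "coeff ((-1) ^ card J * (\<Prod>s\<in>J. [:b s:]) * (\<Prod>s\<in>{1..n} - J. [:0, 1:])) (n - m)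
      = (if card J = m then (-1) ^ m * (\<Prod>s\<in>J. b s) else 0)" if "J \<subseteq> {1..n}" for J
  proof -
    have "card J \<le> n" and fin: "finite J"
      using card_mono[OF _ that] finite_subset[OF that] by auto
    have const: "(\<Prod>s\<in>J. [:b s:]) = [:\<Prod>s\<in>J. b s:]"
      by (induction J rule: infinite_finite_induct) auto
    have sign: "(-1 :: real poly) ^ card J = [:(-1) ^ card J:]"
      by (simp add: fun_eq_iff flip: poly_eq_poly_eq_iff)
    have "(\<Prod>s\<in>{1..n} - J. [:0, 1:]) = (monom 1 (n - card J) :: real poly)"
      using that fin by (simp add: card_Diff_subset monom_altdef)
    then show ?thesis
      using \<open>card J \<le> n\<close> assms by (auto simp: const sign)
  qed
  have "coeff (\<Prod>s\<in>{1..n}. [:- b s, 1:]) (n - m)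
      = (\<Sum>J\<in>Pow {1..n}. if card J = m then (-1) ^ m * (\<Prod>s\<in>J. b s) else 0)"
    unfolding lin prod_diff_conv_sum[OF finite_atLeastAtMost] coeff_sum
    by (intro sum.cong refl summand) auto
  also have "\<dots> = (\<Sum>J | J \<subseteq> {1..n} \<and> card J = m. (-1) ^ m * (\<Prod>s\<in>J. b s))"
    by (intro sum.mono_neutral_cong_right) auto
  finally show ?thesis
    by (simp add: elem_sym_def sum_distrib_left)
qed

section \<open>Chebyshev polynomials of the first kind\<close>

text \<open>The Chebyshev polynomials, characterised by \<open>T n (cos \<theta>) = cos (n * \<theta>)\<close> and defined here by
  their three-term recurrence.\<close>
fun chebyshev :: "nat \<Rightarrow> real poly" where
  "chebyshev 0 = 1"
| "chebyshev (Suc 0) = [:0, 1:]"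
| "chebyshev (Suc (Suc n)) = [:0, 2:] * chebyshev (Suc n) - chebyshev n"

lemma poly_chebyshev_cos: "poly (chebyshev n) (cos \<theta>) = cos (real n * \<theta>)"
proof (induction n rule: chebyshev.induct)
  case (3 n)
  have "cos (real (Suc (Suc n)) * \<theta>) + cos (real n * \<theta>) = 2 * cos \<theta> * cos (real (Suc n) * \<theta>)"
    using cos_plus_cos[of "real (Suc (Suc n)) * \<theta>" "real n * \<theta>"]
    by (simp add: algebra_simps add_divide_distrib)
  then show ?case
    using 3 by (simp add: algebra_simps)
qed auto

lemma coeff_chebyshev_Suc_Suc:
  "coeff (chebyshev (Suc (Suc n))) k
    = (if k = 0 then 0 else 2 * coeff (chebyshev (Suc n)) (k - 1)) - coeff (chebyshev n) k"
  by (cases k) auto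

lemma coeff_chebyshev_odd: "odd (n + k) \<Longrightarrow> coeff (chebyshev n) k = 0"
proof (induction n arbitrary: k rule: chebyshev.induct)
  case (3 n)
  then show ?case
    by (cases k) auto
qed (auto simp: coeff_pCons split: nat.splits intro: odd_pos)

lemma coeff_chebyshev_above: "k > n \<Longrightarrow> coeff (chebyshev n) k = 0"
proof (induction n arbitrary: k rule: chebyshev.induct)
  case (3 n)
  then show ?case
    by (cases k) auto
qed (auto simp: coeff_pCons split: nat.splits)

text \<open>The degree is written as \<open>k + 2 * j\<close>, which avoids subtraction and lets the recurrence relate
  \<open>(k + 1, j + 1)\<close> to \<open>(k, j + 1)\<close> and \<open>(k + 1, j)\<close>. For \<open>k = j = 0\<close> the formula fails.\<close>
lemma coeff_chebyshev_even:
  assumes "k + j \<ge> 1"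
  shows "coeff (chebyshev (k + 2 * j)) k
    = real (k + 2 * j) * (-1) ^ j * 2 ^ k * fact (k + j - 1) / (2 * fact j * fact k)"
  using assms
proof (induction "k + 2 * j" arbitrary: k j rule: less_induct)
  case less
  show ?case
  proof (cases "k + 2 * j \<le> 2")
    case True
    then consider "k = 1" "j = 0" | "k = 2" "j = 0" | "k = 0" "j = 1"
      using less.prems by linarith
    then show ?thesis
      by cases (auto simp: numeral_2_eq_2 coeff_pCons)
  next
    case False
    \<comment> \<open>On the boundary the recurrence has a single term: for \<open>j = 0\<close> the coefficient from two steps
      back lies above the degree, and for \<open>k = 0\<close> the factor \<open>2 * x\<close> leaves no constant term.\<close>
    consider (lead) k' where "j = 0" "k = Suc (Suc k')" "k' \<ge> 1"
      | (const) j' where "k = 0" "j = Suc j'" "j' \<ge> 1"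
      | (inner) k' j' where "k = Suc k'" "j = Suc j'"
    proof (cases k)
      case 0
      with False have "j = Suc (j - 1)" "j - 1 \<ge> 1"
        by auto
      with 0 const show ?thesis by blast
    next
      case (Suc l)
      show ?thesis
      proof (cases j)
        case 0
        with Suc False have "k = Suc (Suc (k - 2))" "k - 2 \<ge> 1"
          by auto
        with 0 lead show ?thesis by blast
      next
        case (Suc l')
        with \<open>k = Suc l\<close> inner show ?thesis by blast
      qed
    qed
    then show ?thesis
    proof cases
      case lead
      have "coeff (chebyshev (Suc k')) (Suc k') = 2 ^ k'"
        using less.hyps[of "Suc k'" 0] lead by (simp del: of_nat_Suc)
      with lead show ?thesis
        by (simp add: coeff_chebyshev_above del: of_nat_Suc)
    next
      case const
      have "coeff (chebyshev (2 * j')) 0 = (-1) ^ j'"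
        using less.hyps[of 0 j'] const by (cases j') (simp_all del: of_nat_Suc, simp add: field_simps)
      with const show ?thesis
        by (cases j') (simp_all del: of_nat_Suc, simp add: field_simps)
    next
      case inner
      have *: "coeff (chebyshev (Suc (k' + 2 * j' + 1))) k'
        = real (k' + 2 * j' + 2) * (-1) ^ Suc j' * 2 ^ k' * fact (k' + j') / (2 * fact (Suc j') * fact k')"
        using less.hyps[of k' "Suc j'"] inner by simp
      have **: "coeff (chebyshev (k' + 2 * j' + 1)) (Suc k')
        = real (k' + 2 * j' + 1) * (-1) ^ j' * 2 ^ Suc k' * fact (k' + j') / (2 * fact j' * fact (Suc k'))"
        using less.hyps[of "Suc k'" j'] inner by simp
      have "coeff (chebyshev (k + 2 * j)) k
        = 2 * coeff (chebyshev (Suc (k' + 2 * j' + 1))) k' - coeff (chebyshev (k' + 2 * j' + 1)) (Suc k')"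
        using coeff_chebyshev_Suc_Suc[of "k' + 2 * j' + 1" k] inner by simp
      also have "\<dots> = real (k' + 2 * j' + 3) * (-1) ^ Suc j' * 2 ^ Suc k' * (real (k' + j' + 1) * fact (k' + j'))
          / (2 * fact (Suc j') * fact (Suc k'))"
        unfolding * ** by (simp add: divide_simps) (simp add: algebra_simps)
      finally show ?thesis
        using inner by (simp add: algebra_simps)
    qed
  qed
qed

section \<open>The factorisation of a shifted Chebyshev polynomial\<close>

lemma prod_diff_cis:
  assumes "n > 0"
  shows "(\<Prod>s\<in>{1..n}. z - cis ((\<xi> + 2 * pi * real s) / real n)) = z ^ n - cis \<xi>"
proof -
  let ?r = "\<lambda>s. cis ((\<xi> + 2 * pi * real s) / real n)"
  let ?p = "\<Prod>s\<in>{1..n}. [:- ?r s, 1:]" and ?q = "monom 1 n - [:cis \<xi>:]"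
  have root: "w \<in> ?r ` {1..n}" if "w ^ n = cis \<xi>" for w
  proof -
    have "(w / cis (\<xi> / n)) ^ n = 1"
      using that assms by (simp add: power_divide DeMoivre)
    then obtain k where k: "k < n" "w / cis (\<xi> / n) = cis (2 * pi * real k / real n)"
      using bij_betw_roots_unity[OF assms] by (auto simp: bij_betw_def)
    \<comment> \<open>The library enumerates the roots of unity by \<open>k = 0, \<dots>, n - 1\<close>; \<open>k = 0\<close> becomes \<open>s = n\<close>.\<close>
    define s where "s = (if k = 0 then n else k)"
    have "w / cis (\<xi> / n) = cis (2 * pi * real s / real n)"
      using k assms by (auto simp: s_def)
    then have "w = cis (\<xi> / n) * cis (2 * pi * real s / real n)"
      by (metis cis_neq_zero nonzero_mult_div_cancel_left times_divide_eq_right)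
    then have "w = ?r s"
      by (simp add: cis_mult add_divide_distrib)
    moreover have "s \<in> {1..n}"
      using k assms by (auto simp: s_def)
    ultimately show ?thesis
      by blast
  qed
  have deg: "degree ?p = n"
    by (subst degree_prod_eq_sum_degree) auto
  have "?p = ?q"
  proof (rule poly_eqI_degree_lead_coeff[where A = "{w. w ^ n = cis \<xi>}"])
    show "n \<le> card {w. w ^ n = cis \<xi>}"
      using card_nth_roots[of "cis \<xi>" n] assms by simp
    have "coeff ?p n = lead_coeff ?p"
      by (simp only: deg)
    also have "\<dots> = 1"
      by (subst lead_coeff_prod) auto
    finally show "coeff ?p n = coeff ?q n"
      using assms by (simp add: coeff_pCons split: nat.splits)
    show "degree ?q \<le> n"
      by (intro degree_diff_le degree_monom_le) auto
    show "poly ?p w = poly ?q w" if "w \<in> {w. w ^ n = cis \<xi>}" for w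
      using root[of w] that by (auto simp: poly_prod poly_monom)
    show "degree ?p \<le> n"
      by (simp only: deg)
  qed
  then have "poly ?p z = poly ?q z"
    by simp
  then show ?thesis
    by (simp add: poly_prod poly_monom)
qed

lemma two_cis_mult_cos_diff:
  "2 * cis \<theta> * complex_of_real (cos \<theta> - cos \<phi>) = (cis \<theta> - cis \<phi>) * (cis \<theta> - cis (- \<phi>))"
proof -
  have "(sin \<theta>)\<^sup>2 = 1 - (cos \<theta>)\<^sup>2" "(sin \<phi>)\<^sup>2 = 1 - (cos \<phi>)\<^sup>2"
    using sin_squared_eq by auto
  then show ?thesis
    by (simp add: complex_eq_iff algebra_simps power2_eq_square)
qed

lemma prod_cos_diff:
  assumes "n > 0"
  shows "2 ^ (n - 1) * (\<Prod>s\<in>{1..n}. cos \<theta> - cos ((\<xi> + 2 * pi * real s) / real n))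
    = cos (real n * \<theta>) - cos \<xi>"
proof -
  let ?\<phi> = "\<lambda>s. (\<xi> + 2 * pi * real s) / real n"
  let ?P = "\<Prod>s\<in>{1..n}. cos \<theta> - cos (?\<phi> s)"
  have conj: "(\<Prod>s\<in>{1..n}. cis \<theta> - cis (- ?\<phi> s)) = cis \<theta> ^ n - cis (- \<xi>)"
    using arg_cong[OF prod_diff_cis[OF assms, of "cis (- \<theta>)" \<xi>], of cnj]
    by (simp add: cis_cnj flip: cis_inverse)
  have "(2 * cis \<theta>) ^ n * complex_of_real ?P
      = (\<Prod>s\<in>{1..n}. 2 * cis \<theta> * complex_of_real (cos \<theta> - cos (?\<phi> s)))"
    by (simp only: prod.distrib of_real_prod prod_constant card_atLeastAtMost) simp
  also have "\<dots> = (\<Prod>s\<in>{1..n}. cis \<theta> - cis (?\<phi> s)) * (\<Prod>s\<in>{1..n}. cis \<theta> - cis (- ?\<phi> s))"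
    unfolding two_cis_mult_cos_diff by (rule prod.distrib)
  also have "\<dots> = (cis (real n * \<theta>) - cis \<xi>) * (cis (real n * \<theta>) - cis (- \<xi>))"
    unfolding conj prod_diff_cis[OF assms] DeMoivre ..
  also have "\<dots> = 2 * cis (real n * \<theta>) * complex_of_real (cos (real n * \<theta>) - cos \<xi>)"
    by (rule two_cis_mult_cos_diff[symmetric])
  finally have "2 ^ n * complex_of_real ?P = 2 * complex_of_real (cos (real n * \<theta>) - cos \<xi>)"
    by (simp add: power_mult_distrib DeMoivre)
  then have "complex_of_real (2 ^ n * ?P) = complex_of_real (2 * (cos (real n * \<theta>) - cos \<xi>))"
    by simp
  then have "2 ^ n * ?P = 2 * (cos (real n * \<theta>) - cos \<xi>)"
    by (simp only: of_real_eq_iff)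
  then show ?thesis
    using assms by (cases n) auto
qed

lemma chebyshev_minus_cos_eq_prod:
  assumes "n > 0"
  shows "chebyshev n - [:cos \<xi>:]
    = smult (2 ^ (n - 1)) (\<Prod>s\<in>{1..n}. [:- cos ((\<xi> + 2 * pi * real s) / real n), 1:])"
    (is "?p = ?q")
proof -
  have "poly (?p - ?q) x = 0" if "x \<in> {-1..1}" for x
  proof -
    from that have "x = cos (arccos x)"
      by simp
    then obtain \<theta> where "x = cos \<theta>" ..
    then show ?thesis
      using prod_cos_diff[OF assms, of \<theta> \<xi>] by (simp add: poly_prod poly_chebyshev_cos)
  qed
  then have "{-1..1} \<subseteq> {x. poly (?p - ?q) x = 0}"
    by blast
  moreover have "infinite {-1..1::real}"
    by (simp add: infinite_Icc)
  ultimately have "?p - ?q = 0"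
    using poly_roots_finite finite_subset by blast
  then show ?thesis
    by simp
qed

section \<open>The elementary symmetric functions of the cosines\<close>

theorem lemma1:
  fixes n :: nat and \<xi> :: real and b :: "nat \<Rightarrow> real"
  assumes "n \<ge> 2"
    and "\<xi> \<in> {0..pi}"
    and "\<And>s. s \<in> {1..n} \<Longrightarrow> b s = cos ((\<xi> + 2 * pi * real s) / real n)"
  shows "(odd n \<longrightarrow> elem_sym n n b = 1 / 2 ^ (n - 1) * cos \<xi>) \<and>
    (even n \<longrightarrow> elem_sym n n b = 1 / 2 ^ (n - 1) * ((-1) ^ (n div 2) - cos \<xi>)) \<and>
    (\<forall>m::nat. odd m \<and> 1 \<le> m \<and> m \<le> n - 1 \<longrightarrow> elem_sym n m b = 0) \<and>
    (\<forall>j::nat. j < n div 2 \<longrightarrow>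
      elem_sym n (2 * j) b =
        real n * (-1) ^ j * (fact (n - j - 1) / (2 ^ (2 * j) * fact j * fact (n - 2 * j))))"
proof -
  have "(\<Prod>s\<in>{1..n}. [:- cos ((\<xi> + 2 * pi * real s) / real n), 1:]) = (\<Prod>s\<in>{1..n}. [:- b s, 1:])"
    using assms(3) by (intro prod.cong) auto
  then have "chebyshev n - [:cos \<xi>:] = smult (2 ^ (n - 1)) (\<Prod>s\<in>{1..n}. [:- b s, 1:])"
    using chebyshev_minus_cos_eq_prod[of n \<xi>] assms(1) by simp
  then have sym: "2 ^ (n - 1) * ((-1) ^ m * elem_sym n m b)
      = coeff (chebyshev n) (n - m) - coeff [:cos \<xi>:] (n - m)" if "m \<le> n" for m
    using coeff_prod_linear[OF that, of b] by (metis coeff_diff coeff_smult)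
  show ?thesis
  proof (intro conjI allI impI)
    assume "odd n"
    then show "elem_sym n n b = 1 / 2 ^ (n - 1) * cos \<xi>"
      using sym[of n] coeff_chebyshev_odd[of n 0] by (simp add: field_simps)
  next
    assume "even n"
    then obtain j where j: "n = 2 * j"
      by (elim evenE)
    with assms(1) have "j \<ge> 1"
      by simp
    then have "coeff (chebyshev n) 0 = (-1) ^ j"
      using coeff_chebyshev_even[of 0 j] j by (cases j) (simp_all del: of_nat_Suc, simp add: field_simps)
    then show "elem_sym n n b = 1 / 2 ^ (n - 1) * ((-1) ^ (n div 2) - cos \<xi>)"
      using sym[of n] j by (simp add: field_simps)
  next
    fix m assume m: "odd m \<and> 1 \<le> m \<and> m \<le> n - 1"
    then have "odd (n + (n - m))" "n - m > 0"
      by auto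
    then show "elem_sym n m b = 0"
      using sym[of m] m coeff_chebyshev_odd[of n "n - m"]
      by (auto simp: coeff_pCons split: nat.splits)
  next
    fix j assume j: "j < n div 2"
    define k where "k = n - 2 * j"
    have n: "n = k + 2 * j" and k: "k > 0"
      using j by (auto simp: k_def)
    have "2 ^ (n - 1) * elem_sym n (2 * j) b
        = real n * (-1) ^ j * 2 ^ k * fact (k + j - 1) / (2 * fact j * fact k)"
      using sym[of "2 * j"] coeff_chebyshev_even[of k j] n k
      by (auto simp: coeff_pCons split: nat.splits)
    then have "2 * 2 ^ (n - 1) * elem_sym n (2 * j) b
        = 2 ^ k * (real n * (-1) ^ j * fact (k + j - 1) / (fact j * fact k))"
      by (simp add: field_simps)
    moreover have "(2::real) * 2 ^ (n - 1) = 2 ^ k * 2 ^ (2 * j)"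
      using n k by (simp flip: power_add power_Suc)
    ultimately have "2 ^ k * (2 ^ (2 * j) * elem_sym n (2 * j) b)
        = 2 ^ k * (real n * (-1) ^ j * fact (k + j - 1) / (fact j * fact k))"
      by (simp only: mult.assoc)
    then have "2 ^ (2 * j) * elem_sym n (2 * j) b
        = real n * (-1) ^ j * fact (k + j - 1) / (fact j * fact k)"
      by (subst (asm) mult_cancel_left) simp
    moreover have "n - j - 1 = k + j - 1" "n - 2 * j = k"
      using n by auto
    ultimately show "elem_sym n (2 * j) b =
        real n * (-1) ^ j * (fact (n - j - 1) / (2 ^ (2 * j) * fact j * fact (n - 2 * j)))"
      by (simp add: field_simps)
  qed
qed

end
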